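(* Let $\tau\in\mathbb{Z}$, $m\geq 1$ and $l\geq 0$ be integers. Define $$c_{m,l}(\tau)=-\frac{(-1)^{m\tau+m+l}}{m^2}\binom{m}{l}\binom{m\tau+l-1}{m-1}$$ and $$n_{m,l}(\tau)=\sum_{d\mid m,\ d\mid l}\frac{\mu(d)}{d^2}\,c_{\frac{m}{d},\frac{l}{d}}(\tau),$$ where $\mu$ is the Möbius function and the sum runs over positive integers $d$ dividing both $m$ and $l$ (every $d$ divides $0$). Then $n_{m,l}(\tau)\in\mathbb{Z}$.
   Context: For integers $b\geq 0$ and $a\in\mathbb{Z}$ the binomial coefficient is defined by: $\binom{a}{b}=1$ if $b=0$; $\binom{a}{b}$ is the usual binomial coefficient if $b\geq 1$ and $a\geq 0$ (so it is $0$ when $b>a$); and $\binom{a}{b}=(-1)^b\binom{-a+b-1}{b}$ if $b\geq1$ and $a<0$. (The numbers $n_{m,l}(\tau)$ are the genus-zero LMOV invariants $n_{(m),0,l-m/2}$ of the unknot with framing $\tau$.) *)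

theory Defs
  imports Complex_Main "HOL-Computational_Algebra.Primes" "HOL-Computational_Algebra.Squarefree"
begin

definition gbinom :: "int \<Rightarrow> nat \<Rightarrow> int" where
  "gbinom a b =
     (if b = 0 then 1
      else if a \<ge> 0 then int (nat a choose b)
      else (-1) ^ b * int (nat (- a + int b - 1) choose b))"

definition moebius :: "nat \<Rightarrow> int" where
  "moebius d = (if squarefree d then (-1) ^ card (prime_factors d) else 0)"

definition c_coef :: "int \<Rightarrow> nat \<Rightarrow> nat \<Rightarrow> rat" where
  "c_coef \<tau> m l =
     - ((-1) powi (int m * \<tau> + int m + int l) / of_nat (m ^ 2))
       * of_int (gbinom (int m) l) * of_int (gbinom (int m * \<tau> + int l - 1) (m - 1))"

definition n_coef :: "int \<Rightarrow> nat \<Rightarrow> nat \<Rightarrow> rat" where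
  "n_coef \<tau> m l =
     (\<Sum>d \<in> {d. 0 < d \<and> d dvd m \<and> d dvd l}.
        of_int (moebius d) / of_nat (d ^ 2) * c_coef \<tau> (m div d) (l div d))"

end

theory Submission
  imports Defs "HOL-Number_Theory.Cong"
begin

text \<open>
  Up to sign, \<open>m\<^sup>2 n\<^sub>m\<^sub>,\<^sub>l\<close> is the sum of \<open>\<mu>(d) f(m/d, l/d)\<close>, where \<open>f(m, l)\<close> is the signed product of
  the two binomial coefficients. Let \<open>p\<^sup>a\<close> be the exact power of a prime \<open>p\<close> dividing \<open>m\<close>; it
  suffices that \<open>p\<^sup>2\<^sup>a\<close> divides this sum. If \<open>p\<close> does not divide \<open>l\<close>, absorption shows that both
  binomials of each term are divisible by \<open>p\<^sup>a\<close>. Otherwise the terms for \<open>d\<close> and \<open>p d\<close> are paired,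
  and the claim is \<open>f(p m, p l) \<equiv> f(m, l)\<close> modulo \<open>p\<^sup>2\<^sup>a\<close>. The ratio of the binomials
  involved is a product of \<open>(N - i) / i\<close> over \<open>0 < i < k\<close> prime to \<open>p\<close>; if \<open>p\<^sup>e\<close> divides \<open>N\<close> and \<open>k\<close>,
  combining \<open>i\<close> with \<open>k - i\<close> shows that it is \<open>\<plusminus>1\<close> modulo \<open>p\<^sup>2\<^sup>e\<close>, and absorption supplies the
  remaining factor \<open>p\<^bsup>2(a-e)\<^esup>\<close>. The sign differs from 1 only for \<open>p = 2\<close>, where it is exactly
  compensated by the sign in \<open>f\<close>.
\<close>

section \<open>Binomial coefficients with integer upper argument\<close>

text \<open>For negative \<open>a\<close> the definition is the rule of upper negation, so
  \<open>gbinom\<close> inherits the identities of \<open>gchoose\<close>.\<close>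

lemma of_int_gbinom: "rat_of_int (gbinom a k) = of_int a gchoose k"
proof -
  consider "k = 0" | "k > 0" "a \<ge> 0" | "k > 0" "a < 0" by linarith
  then show ?thesis
  proof cases
    case 2
    then show ?thesis
      by (simp add: gbinom_def binomial_gbinomial)
  next
    case 3
    have "rat_of_nat (nat (- a + int k - 1)) = of_nat k - of_int a - 1"
      using 3 by simp
    then show ?thesis
      using 3 by (simp add: gbinom_def binomial_gbinomial gbinomial_negated_upper[of "rat_of_int a"])
  qed (simp add: gbinom_def)
qed

lemma gbinom_absorption:
  assumes "k > 0"
  shows "int k * gbinom a k = a * gbinom (a - 1) (k - 1)"
proof -
  obtain j where k: "k = Suc j" using assms by (cases k) auto
  have "rat_of_int (int k * gbinom a k) = rat_of_int (a * gbinom (a - 1) (k - 1))"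
    using gbinomial_absorption[of j "rat_of_int a"] by (simp add: of_int_gbinom k)
  then show ?thesis by linarith
qed

text \<open>The index starts at 1 so that each factor \<open>a - i\<close> faces the factor
  \<open>i\<close> of \<open>fact (k - 1)\<close>.\<close>

lemma fact_mult_gbinom:
  assumes "k > 0"
  shows "fact (k - 1) * gbinom (a - 1) (k - 1) = (\<Prod>i = 1..<k. a - int i)"
proof -
  obtain j where k: "k = Suc j" using assms by (cases k) auto
  have "rat_of_int (fact (k - 1) * gbinom (a - 1) (k - 1)) = (\<Prod>i = 0..<j. rat_of_int a - 1 - of_nat i)"
    by (simp add: of_int_gbinom gbinomial_mult_fact k)
  also have "\<dots> = (\<Prod>i = 0..<j. rat_of_int (a - int (Suc i)))"
    by (intro prod.cong) auto
  also have "\<dots> = (\<Prod>i = Suc 0..<Suc j. rat_of_int (a - int i))"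
    by (subst prod.shift_bounds_Suc_ivl) simp
  also have "\<dots> = rat_of_int (\<Prod>i = 1..<k. a - int i)" by (simp add: k)
  finally show ?thesis by linarith
qed

section \<open>Scaling both arguments of a binomial coefficient by \<open>p\<close>\<close>

lemma prod_split_multiples:
  fixes g :: "nat \<Rightarrow> 'a::comm_monoid_mult"
  assumes "p > 0"
  shows "(\<Prod>i = 1..<p * k. g i) = (\<Prod>j = 1..<k. g (p * j)) * (\<Prod>i | i \<in> {1..<p * k} \<and> \<not> p dvd i. g i)"
proof -
  let ?D = "{i. i \<in> {1..<p * k} \<and> p dvd i}" and ?U = "{i. i \<in> {1..<p * k} \<and> \<not> p dvd i}"
  have D: "?D = (\<lambda>j. p * j) ` {1..<k}"
    using assms by (auto elim!: dvdE)
  have "{1..<p * k} = ?D \<union> ?U" by auto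
  then have "(\<Prod>i = 1..<p * k. g i) = prod g (?D \<union> ?U)" by (rule arg_cong)
  also have "\<dots> = prod g ?D * prod g ?U"
    by (rule prod.union_disjoint) auto
  also have "prod g ?D = (\<Prod>j = 1..<k. g (p * j))"
    unfolding D using assms by (subst prod.reindex) (auto simp: inj_on_def)
  finally show ?thesis .
qed

text \<open>In numerator and denominator, the factors whose index is a multiple of \<open>p\<close>
  give \<open>p ^ (k - 1)\<close> times those of \<open>gbinom (N - 1) (k - 1)\<close>; the other
  factors remain as the two products.\<close>

lemma gbinom_multiples_pred:
  fixes N :: int
  assumes p: "p > 0" and k: "k > 0"
  shows "gbinom (int p * N - 1) (p * k - 1) * (\<Prod>i | i \<in> {1..<p * k} \<and> \<not> p dvd i. int i)
       = gbinom (N - 1) (k - 1) * (\<Prod>i | i \<in> {1..<p * k} \<and> \<not> p dvd i. int p * N - int i)"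
    (is "?B * ?Q = ?b * ?P")
proof -
  have split_fact: "fact (p * k - 1) = int p ^ (k - 1) * fact (k - 1) * ?Q"
  proof -
    have "fact n = (\<Prod>i = 1..<Suc n. int i)" for n
      by (simp add: fact_prod atLeastLessThanSuc_atLeastAtMost)
    from this[of "p * k - 1"] this[of "k - 1"] show ?thesis
      using p k prod_split_multiples[of p "\<lambda>i. int i" k] by (simp add: prod.distrib)
  qed
  have "fact (p * k - 1) * ?B = (\<Prod>i = 1..<p * k. int p * N - int i)"
    using p k by (intro fact_mult_gbinom) simp
  also have "\<dots> = (\<Prod>j = 1..<k. int p * N - int (p * j)) * ?P"
    by (rule prod_split_multiples[OF p])
  also have "(\<Prod>j = 1..<k. int p * N - int (p * j)) = (\<Prod>j = 1..<k. int p * (N - int j))"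
    by (intro prod.cong) (auto simp: algebra_simps)
  also have "\<dots> = int p ^ (k - 1) * (fact (k - 1) * ?b)"
    by (simp only: prod.distrib prod_constant card_atLeastLessThan fact_mult_gbinom[OF k])
  finally have "(int p ^ (k - 1) * fact (k - 1)) * (?B * ?Q) = (int p ^ (k - 1) * fact (k - 1)) * (?b * ?P)"
    unfolding split_fact by (simp add: algebra_simps)
  moreover have "int p ^ (k - 1) * fact (k - 1) \<noteq> 0" using p by simp
  ultimately show ?thesis using mult_left_cancel by blast
qed

text \<open>Absorption reduces this to the shifted case, because scaling by \<open>p\<close>
  preserves the quotient \<open>N / k\<close>.\<close>

lemma gbinom_multiples:
  assumes p: "p > 0"
  shows "gbinom (int p * N) (p * k) * (\<Prod>i | i \<in> {1..<p * k} \<and> \<not> p dvd i. int i)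
       = gbinom N k * (\<Prod>i | i \<in> {1..<p * k} \<and> \<not> p dvd i. int p * N - int i)"
    (is "?B * ?Q = ?b * ?P")
proof (cases "k = 0")
  case True
  then show ?thesis by (simp add: gbinom_def)
next
  case False
  have "int (p * k) * ?B = int p * N * gbinom (int p * N - 1) (p * k - 1)"
    using False p by (intro gbinom_absorption) simp
  then have "int k * ?B = N * gbinom (int p * N - 1) (p * k - 1)"
    using p by simp
  then have "int k * (?B * ?Q) = N * (gbinom (int p * N - 1) (p * k - 1) * ?Q)"
    by (simp only: mult.assoc[symmetric])
  also have "\<dots> = N * gbinom (N - 1) (k - 1) * ?P"
    using False p by (subst gbinom_multiples_pred) auto
  also have "\<dots> = int k * (?b * ?P)"
    using False gbinom_absorption[of k N] by simp
  finally show ?thesis using False by simp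
qed

section \<open>Congruences and divisibility modulo prime powers\<close>

text \<open>The reflection \<open>i\<close> to \<open>k - i\<close> pairs the factors. A sign can
  come only from its fixed point \<open>k / 2\<close>, which is prime to \<open>p\<close> only if
  \<open>p = 2\<close> and \<open>k / 2\<close> is odd.\<close>

lemma prod_coprime_residues_cong:
  fixes N :: int
  assumes p: "prime p" and e: "e > 0" and k: "p ^ e dvd k" and N: "int p ^ e dvd N"
  shows "[(\<Prod>i | i \<in> {1..<k} \<and> \<not> p dvd i. N - int i)
        = (if p = 2 \<and> odd (k div 2) \<and> even (N div 2) then -1 else 1)
          * (\<Prod>i | i \<in> {1..<k} \<and> \<not> p dvd i. int i)] (mod (int p ^ (2 * e)))"
proof -
  let ?U = "{i. i \<in> {1..<k} \<and> \<not> p dvd i}"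
  let ?m = "int p ^ (2 * e)"
  let ?s = "if p = 2 \<and> odd (k div 2) \<and> even (N div 2) then -1 else 1 :: int"
  define L where "L = {i \<in> ?U. 2 * i < k}"
  define M where "M = {i \<in> ?U. 2 * i = k}"
  define H where "H = {i \<in> ?U. 2 * i > k}"
  have pk: "p dvd k" using e k dvd_trans[of p "p ^ e" k] by simp
  have fin: "finite L" "finite M" "finite H" by (auto simp: L_def M_def H_def)
  have pdiff: "p dvd k - i \<longleftrightarrow> p dvd i" if "i < k" for i
    using pk that by (metis dvd_diffD1 dvd_diff_nat less_imp_le)
  have H: "H = (\<lambda>i. k - i) ` L"
  proof (intro equalityI subsetI)
    fix i assume "i \<in> H"
    then have "k - i \<in> L" "i = k - (k - i)"
      by (auto simp: H_def L_def pdiff)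
    then show "i \<in> (\<lambda>i. k - i) ` L" by blast
  next
    fix j assume "j \<in> (\<lambda>i. k - i) ` L"
    then show "j \<in> H"
      by (auto simp: H_def L_def pdiff)
  qed
  have split: "prod g ?U = (\<Prod>i\<in>L. g i * g (k - i)) * prod g M" for g :: "nat \<Rightarrow> int"
  proof -
    have "?U = (L \<union> H) \<union> M" by (auto simp: L_def M_def H_def)
    then have "prod g ?U = prod g ((L \<union> H) \<union> M)" by simp
    also have "\<dots> = prod g (L \<union> H) * prod g M"
      using fin by (intro prod.union_disjoint) (auto simp: L_def M_def H_def)
    also have "prod g (L \<union> H) = prod g L * prod g H"
      using fin by (intro prod.union_disjoint) (auto simp: L_def M_def H_def)
    also have "prod g H = (\<Prod>i\<in>L. g (k - i))"
      unfolding H by (subst prod.reindex) (auto simp: inj_on_def L_def)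
    finally show ?thesis by (simp add: prod.distrib)
  qed
  have mid: "[(\<Prod>i\<in>M. N - int i) = ?s * (\<Prod>i\<in>M. int i)] (mod ?m)"
  proof (cases "p = 2 \<and> odd (k div 2)")
    case True
    then obtain j where j: "k = 2 * j" "odd j" using pk by auto
    \<comment> \<open>Here \<open>i = k / 2\<close> is its own partner, but \<open>p\<^sup>e = 2\<close>, so a congruence modulo 4 suffices.\<close>
    have "e = 1"
    proof (rule ccontr)
      assume "e \<noteq> 1"
      then have "2 ^ 2 dvd k"
        using e k True power_le_dvd[of 2 e k 2] by simp
      then show False using j by auto
    qed
    moreover have "M = {j}" using j True odd_pos[OF j(2)] by (auto simp: M_def)
    \<comment> \<open>An even \<open>n\<close> makes \<open>N\<close> vanish modulo 4; for odd
      \<open>n\<close> the difference \<open>N - 2 * j\<close> is twice an even number.\<close>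
    moreover have "[N - int j = ?s * int j] (mod 4)"
    proof -
      obtain n where n: "N = 2 * n" using N True \<open>e = 1\<close> by auto
      obtain i where i: "int j = 2 * i + 1" using j(2) by (metis even_of_nat oddE)
      show ?thesis
      proof (cases "even n")
        case True
        then show ?thesis using \<open>p = 2 \<and> _\<close> n by (auto simp: cong_iff_dvd_diff)
      next
        case False
        then obtain t where "n = 2 * t + 1" by (elim oddE)
        then have "N - int j - int j = 4 * (t - i)" using n i by simp
        then show ?thesis using False n by (auto simp: cong_iff_dvd_diff)
      qed
    qed
    ultimately show ?thesis using True by simp
  next
    case False
    have "M = {}"
    proof (rule ccontr)
      assume "M \<noteq> {}"
      then obtain i where i: "2 * i = k" "\<not> p dvd i" by (auto simp: M_def)
      then have "p dvd 2" using pk p by (metis prime_dvd_mult_iff)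
      then have "p = 2" using p by (metis primes_dvd_imp_eq two_is_prime_nat)
      then show False using i False by auto
    qed
    then show ?thesis using False by auto
  qed
  \<comment> \<open>\<open>(N - i) (N - (k - i)) = i (k - i) + N (N - k)\<close>\<close>
  have pair: "[(N - int i) * (N - int (k - i)) = int i * int (k - i)] (mod ?m)" if "i \<in> L" for i
  proof -
    have "(N - int i) * (N - int (k - i)) - int i * int (k - i) = N * (N - int k)"
      using that by (simp add: L_def of_nat_diff algebra_simps)
    moreover have "?m dvd N * (N - int k)"
    proof -
      have "int p ^ e dvd int k" using k by (metis of_nat_dvd_iff of_nat_power)
      then show ?thesis using N by (simp add: power_add mult_2 mult_dvd_mono)
    qed
    ultimately show ?thesis by (simp add: cong_iff_dvd_diff)
  qed
  have "[(\<Prod>i\<in>L. (N - int i) * (N - int (k - i))) * (\<Prod>i\<in>M. N - int i)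
       = (\<Prod>i\<in>L. int i * int (k - i)) * (?s * (\<Prod>i\<in>M. int i))] (mod ?m)"
    by (intro cong_mult cong_prod mid pair)
  then show ?thesis
    unfolding split[of "\<lambda>i. N - int i"] split[of int] by (simp only: mult.left_commute mult.assoc)
qed

text \<open>Absorption gives \<open>u * y = m * x\<close>, where \<open>y\<close> is the binomial
  and \<open>u\<close> is \<open>l\<close> or \<open>m * \<tau> + l\<close>. If
  \<open>e < a\<close>, then \<open>u\<close> accounts for exactly \<open>e\<close> factors
  \<open>p\<close>, so the other \<open>a - e\<close> divide \<open>y\<close>.\<close>

lemma prime_power_dvd_gbinom:
  assumes p: "prime p" and m: "p ^ a dvd m" and e: "e = a \<or> \<not> p ^ Suc e dvd l" "e \<le> a" and l: "p ^ e dvd l"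
    and "m > 0"
  shows "int p ^ (a - e) dvd gbinom (int m) l"
    and "int p ^ (a - e) dvd gbinom (int m * \<tau> + int l - 1) (m - 1)"
proof -
  have pos: "p > 0" using p prime_gt_0_nat by blast
  have key: "int p ^ (a - e) dvd y" if uy: "u * y = int m * x" and nd: "e = a \<or> \<not> int p ^ Suc e dvd u" and u: "int p ^ e dvd u" for u x y
  proof (cases "e = a")
    case False
    obtain w where w: "u = int p ^ e * w" using u by (rule dvdE)
    have "\<not> int p dvd w" using nd False w by auto
    then have "coprime (int p ^ (a - e)) w"
      using p by (simp add: prime_imp_coprime)
    moreover have "int p ^ a dvd u * y" 
      using m uy by (metis dvd_mult2 of_nat_dvd_iff of_nat_power)
    then have "int p ^ e * int p ^ (a - e) dvd int p ^ e * (w * y)"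
      using w e(2) by (simp add: power_add[symmetric] mult.assoc)
    then have "int p ^ (a - e) dvd w * y" using pos by simp
    ultimately show ?thesis by (simp add: coprime_dvd_mult_right_iff)
  qed simp
  have l': "e = a \<or> \<not> int p ^ Suc e dvd int l" "int p ^ e dvd int l"
    using e l by (metis of_nat_dvd_iff of_nat_power)+
  have mi: "int p ^ a dvd int m" using m by (metis of_nat_dvd_iff of_nat_power)
  show "int p ^ (a - e) dvd gbinom (int m) l"
  proof (cases "l = 0")
    \<comment> \<open>Every power of \<open>p\<close> divides 0, so \<open>e = a\<close> and the
      claimed divisor is 1.\<close>
    case True
    then show ?thesis using e by auto
  next
    case False
    then show ?thesis using l' by (intro key[OF gbinom_absorption]) auto
  qed
  have N: "(int m * \<tau> + int l) * gbinom (int m * \<tau> + int l - 1) (m - 1) = int m * gbinom (int m * \<tau> + int l) m"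
    using \<open>m > 0\<close> by (simp add: gbinom_absorption)
  show "int p ^ (a - e) dvd gbinom (int m * \<tau> + int l - 1) (m - 1)"
  proof (rule key[OF N])
    have "int p ^ e dvd int m" using mi e(2) power_le_dvd by blast
    then show "int p ^ e dvd int m * \<tau> + int l" using l' by simp
    \<comment> \<open>Below the cap, \<open>p ^ Suc e\<close> divides \<open>m\<close>, so adding
      \<open>m * \<tau>\<close> to \<open>l\<close> does not affect divisibility.\<close>
    show "e = a \<or> \<not> int p ^ Suc e dvd int m * \<tau> + int l"
    proof (cases "e = a")
      case False
      then have "int p ^ Suc e dvd int m" using mi e(2) power_le_dvd[of "int p" a "int m" "Suc e"] by simp
      then show ?thesis using l' by (metis dvd_add_right_iff dvd_mult2)
    qed simp
  qed
qed

section \<open>The signed product of binomials and its scaling by a prime\<close>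

text \<open>This is \<open>f\<close> of the overview. The sign is read off from parity since the
  exponent may be negative, and the value stays an integer.\<close>

definition signed_binoms :: "int \<Rightarrow> nat \<Rightarrow> nat \<Rightarrow> int" where
  "signed_binoms \<tau> m l =
     (if even (int m * \<tau> + int m + int l) then 1 else -1)
       * gbinom (int m) l * gbinom (int m * \<tau> + int l - 1) (m - 1)"

lemma c_coef_eq: "c_coef \<tau> m l = - of_int (signed_binoms \<tau> m l) / of_nat (m ^ 2)"
  by (simp add: c_coef_def signed_binoms_def power_int_minus_left)

text \<open>\<open>e\<close> is the smaller of \<open>a\<close> and the exponent of \<open>p\<close>
  in \<open>l\<close>. The case \<open>l = 0\<close> falls under \<open>e = a\<close>, so
  \<open>multiplicity\<close> is needed only for nonzero \<open>l\<close>.\<close>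

lemma obtain_common_prime_power:
  fixes p :: nat
  assumes "prime p"
  obtains e where "e \<le> a" "p ^ e dvd l" "e = a \<or> \<not> p ^ Suc e dvd l"
proof (cases "p ^ a dvd l")
  case True
  then show ?thesis using that by blast
next
  case False
  then have "l \<noteq> 0" by (metis dvd_0_right)
  have *: "p ^ multiplicity p l dvd l" by (rule multiplicity_dvd)
  moreover have "\<not> p ^ Suc (multiplicity p l) dvd l"
    using \<open>l \<noteq> 0\<close> assms by (metis multiplicity_geI not_prime_unit not_less_eq_eq order_refl)
  moreover have "multiplicity p l \<le> a"
    using False * by (metis dvd_trans le_imp_power_dvd nat_le_linear)
  ultimately show ?thesis using that by blast
qed

text \<open>The exponent is \<open>2 * (a - e) + 2 * Suc e\<close>: the first part comes from the
  binomials at \<open>m\<close> and \<open>l\<close>, the second from the products of factors prime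
  to \<open>p\<close>, as \<open>p ^ Suc e\<close> divides \<open>p * m\<close>,
  \<open>p * l\<close> and \<open>p * n\<close>.\<close>

lemma signed_binoms_prime_cong:
  assumes p: "prime p" and m: "p ^ Suc a dvd p * m" and "m > 0"
  shows "int p ^ (2 * Suc a) dvd signed_binoms \<tau> (p * m) (p * l) - signed_binoms \<tau> m l"
proof -
  have pos: "p > 0" using p prime_gt_0_nat by blast
  have m': "p ^ a dvd m" using m pos by simp
  obtain e where e: "e \<le> a" "p ^ e dvd l" "e = a \<or> \<not> p ^ Suc e dvd l"
    using obtain_common_prime_power[OF p] .
  let ?U = "\<lambda>k. {i. i \<in> {1..<k} \<and> \<not> p dvd i}"
  define n where "n = int m * \<tau> + int l"
  define Q where "Q = (\<Prod>i\<in>?U (p * l). int i) * (\<Prod>i\<in>?U (p * m). int i)"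
  define P where "P = (\<Prod>i\<in>?U (p * l). int p * int m - int i) * (\<Prod>i\<in>?U (p * m). int p * n - int i)"
  define X where "X = gbinom (int p * int m) (p * l) * gbinom (int p * n - 1) (p * m - 1)"
  define x where "x = gbinom (int m) l * gbinom (n - 1) (m - 1)"
  \<comment> \<open>These are the signs of \<open>prod_coprime_residues_cong\<close>; for
    \<open>p = 2\<close> the halves of \<open>p * l\<close>, \<open>p * m\<close>,
    \<open>p * n\<close> are \<open>l\<close>, \<open>m\<close>, \<open>n\<close>.\<close>
  define s where "s = (if p = 2 \<and> odd l \<and> even m then -1 else 1) * (if p = 2 \<and> odd m \<and> even n then -1 else 1 :: int)"
  have XQ: "X * Q = x * P"
  proof -
    have "X * Q = (gbinom (int p * int m) (p * l) * (\<Prod>i\<in>?U (p * l). int i))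
        * (gbinom (int p * n - 1) (p * m - 1) * (\<Prod>i\<in>?U (p * m). int i))"
      by (simp add: X_def Q_def ac_simps)
    also have "\<dots> = x * P"
      unfolding gbinom_multiples_pred[OF pos \<open>m > 0\<close>] gbinom_multiples[OF pos]
      by (simp add: x_def P_def ac_simps)
    finally show ?thesis .
  qed
  have de: "int p ^ e dvd int m"
    using m' e(1) by (metis dvd_trans le_imp_power_dvd of_nat_dvd_iff of_nat_power)
  have dn: "int p ^ e dvd n"
    using de e(2) unfolding n_def by (metis dvd_add dvd_mult2 of_nat_dvd_iff of_nat_power)
  have PQ: "int p ^ (2 * Suc e) dvd P - s * Q"
  proof -
    have "[(\<Prod>i\<in>?U (p * l). int p * int m - int i) = 
        (if p = 2 \<and> odd (p * l div 2) \<and> even (int p * int m div 2) then -1 else 1) * (\<Prod>i\<in>?U (p * l). int i)] (mod int p ^ (2 * Suc e))"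
      using de e(2) by (intro prod_coprime_residues_cong[OF p]) auto
    moreover have "[(\<Prod>i\<in>?U (p * m). int p * n - int i) = 
        (if p = 2 \<and> odd (p * m div 2) \<and> even (int p * n div 2) then -1 else 1) * (\<Prod>i\<in>?U (p * m). int i)] (mod int p ^ (2 * Suc e))"
      using de dn by (intro prod_coprime_residues_cong[OF p]) (auto simp flip: of_nat_power)
    ultimately have "[P = ((if p = 2 \<and> odd (p * l div 2) \<and> even (int p * int m div 2) then -1 else 1)
          * (\<Prod>i\<in>?U (p * l). int i))
        * ((if p = 2 \<and> odd (p * m div 2) \<and> even (int p * n div 2) then -1 else 1)
          * (\<Prod>i\<in>?U (p * m). int i))] (mod int p ^ (2 * Suc e))"
      unfolding P_def by (rule cong_mult)
    also have "((if p = 2 \<and> odd (p * l div 2) \<and> even (int p * int m div 2) then -1 else 1)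
          * (\<Prod>i\<in>?U (p * l). int i))
        * ((if p = 2 \<and> odd (p * m div 2) \<and> even (int p * n div 2) then -1 else 1)
          * (\<Prod>i\<in>?U (p * m). int i)) = s * Q"
      by (auto simp: s_def Q_def)
    finally have "[P = s * Q] (mod int p ^ (2 * Suc e))" .
    then show ?thesis by (simp add: cong_iff_dvd_diff)
  qed
  have "int p ^ (a - e) * int p ^ (a - e) dvd x"
    unfolding x_def n_def using prime_power_dvd_gbinom[OF p m' e(3) e(1) e(2) \<open>m > 0\<close>]
    by (intro mult_dvd_mono)
  then have "int p ^ (a - e) * int p ^ (a - e) * int p ^ (2 * Suc e) dvd x * (P - s * Q)"
    using PQ by (rule mult_dvd_mono)
  also have "int p ^ (a - e) * int p ^ (a - e) * int p ^ (2 * Suc e) = int p ^ (2 * Suc a)"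
    using e(1) by (simp flip: power_add)
  also have "x * (P - s * Q) = (X - s * x) * Q"
    using XQ by (simp add: algebra_simps)
  finally have "int p ^ (2 * Suc a) dvd (X - s * x) * Q" .
  moreover have "coprime (int p ^ (2 * Suc a)) Q"
    unfolding Q_def using p
    by (auto intro!: prod_coprime_right prime_imp_coprime)
  ultimately have dvd: "int p ^ (2 * Suc a) dvd X - s * x"
    by (simp add: coprime_dvd_mult_left_iff)
  define t where "t = (if even (int m * \<tau> + int m + int l) then 1 else -1 :: int)"
  define T where "T = (if even (int (p * m) * \<tau> + int (p * m) + int (p * l)) then 1 else -1 :: int)"
  \<comment> \<open>Scaling by an odd \<open>p\<close> keeps the parity of the exponent, and
    \<open>s = 1\<close>. For \<open>p = 2\<close>, \<open>T = 1\<close> and the exponent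
    \<open>n + m\<close> is odd iff \<open>l\<close> is odd (\<open>m\<close> even) or
    \<open>n\<close> is even (\<open>m\<close> odd).\<close>
  have "t = T * s"
  proof (cases "p = 2")
    case False
    then have "odd p" using p by (metis primes_dvd_imp_eq two_is_prime_nat)
    then show ?thesis using False by (simp add: t_def T_def s_def)
  next
    case True
    then show ?thesis by (auto simp: t_def T_def s_def n_def)
  qed
  moreover have "signed_binoms \<tau> (p * m) (p * l) = T * X"
    by (simp add: signed_binoms_def T_def X_def n_def algebra_simps)
  moreover have "signed_binoms \<tau> m l = t * x"
    by (simp add: signed_binoms_def t_def x_def n_def)
  ultimately have "signed_binoms \<tau> (p * m) (p * l) - signed_binoms \<tau> m l = T * (X - s * x)"
    by (simp add: algebra_simps)
  then show ?thesis using dvd by simp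
qed

section \<open>The Moebius sum at one prime\<close>

lemma moebius_prime_mult:
  assumes p: "prime p" and d: "\<not> p dvd d"
  shows "moebius (p * d) = - moebius d"
proof -
  have cop: "coprime p d" using p d by (simp add: prime_imp_coprime)
  have sq: "squarefree (p * d) \<longleftrightarrow> squarefree d"
    using cop p squarefree_multD(2) by (metis squarefree_mult_coprime squarefree_prime)
  have "d \<noteq> 0" using d by (metis dvd_0_right)
  then have "prime_factors (p * d) = insert p (prime_factors d)"
    using p by (simp add: prime_factors_product prime_factorization_prime)
  moreover have "p \<notin> prime_factors d" using d by auto
  ultimately have "card (prime_factors (p * d)) = Suc (card (prime_factors d))" by simp
  then show ?thesis by (simp add: moebius_def sq)
qed

lemma moebius_square_dvd:
  assumes "prime p" "p ^ 2 dvd d"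
  shows "moebius d = 0"
  using assms squarefreeD[of d p] by (auto simp: moebius_def)

definition moebius_binom_sum :: "int \<Rightarrow> nat \<Rightarrow> nat \<Rightarrow> int" where
  "moebius_binom_sum \<tau> m l =
     (\<Sum>d | 0 < d \<and> d dvd m \<and> d dvd l. moebius d * signed_binoms \<tau> (m div d) (l div d))"

text \<open>The denominators \<open>d ^ 2\<close> and \<open>(m div d) ^ 2\<close> multiply to
  \<open>m ^ 2\<close> for every \<open>d\<close>, so integrality becomes divisibility of an integer
  by \<open>m ^ 2\<close>.\<close>

lemma n_coef_eq:
  assumes "m > 0"
  shows "n_coef \<tau> m l = - of_int (moebius_binom_sum \<tau> m l) / of_nat (m ^ 2)"
proof -
  have "of_int (moebius d) / of_nat (d ^ 2) * c_coef \<tau> (m div d) (l div d)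
      = - of_int (moebius d * signed_binoms \<tau> (m div d) (l div d)) / rat_of_nat (m ^ 2)"
    if "d dvd m" "0 < d" for d
  proof -
    obtain q where "m = d * q" using \<open>d dvd m\<close> by (rule dvdE)
    then show ?thesis using that assms by (simp add: c_coef_eq power_mult_distrib)
  qed
  then show ?thesis
    unfolding n_coef_def moebius_binom_sum_def
    by (simp add: sum_negf sum_divide_distrib)
qed

lemma prime_power_dvd_div:
  fixes p :: nat
  assumes "prime p" "p ^ a dvd m" "d dvd m" "\<not> p dvd d"
  shows "p ^ a dvd m div d"
proof -
  obtain q where q: "m = d * q" using assms(3) by auto
  have "d > 0" using assms(4) by (metis dvd_0_right gr0I)
  moreover have "coprime (p ^ a) d" using assms by (simp add: prime_imp_coprime)
  ultimately show ?thesis using q assms(2) by (simp add: coprime_dvd_mult_right_iff)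
qed

lemma prime_power_dvd_moebius_binom_sum:
  assumes p: "prime p" and m: "p ^ a dvd m" and "m > 0"
  shows "int p ^ (2 * a) dvd moebius_binom_sum \<tau> m l"
proof (cases "p dvd m \<and> p dvd l")
  \<comment> \<open>Every \<open>d\<close> is prime to \<open>p\<close>, and for
    \<open>a > 0\<close> so is \<open>l\<close>; thus \<open>e = 0\<close> and each term is
    divisible on its own.\<close>
  case False
  show ?thesis
    unfolding moebius_binom_sum_def
  proof (rule dvd_sum, clarify)
    fix d assume d: "0 < d" "d dvd m" "d dvd l"
    have "\<not> p dvd d" using False d dvd_trans by blast
    then have md: "p ^ a dvd m div d" using p m d prime_power_dvd_div by blast
    show "int p ^ (2 * a) dvd moebius d * signed_binoms \<tau> (m div d) (l div d)"
    proof (cases "a = 0")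
      case a: False
      then have "\<not> p dvd l" using False m dvd_trans[of p "p ^ a" m] by simp
      then have "\<not> p ^ Suc 0 dvd l div d" using d(3) by (metis dvd_div_mult_self dvd_mult2 power_Suc0_right)
      moreover have "m div d > 0" using d \<open>m > 0\<close> by (simp add: dvd_imp_le div_greater_zero_iff)
      ultimately have "int p ^ (a - 0) * int p ^ (a - 0)
          dvd gbinom (int (m div d)) (l div d) * gbinom (int (m div d) * \<tau> + int (l div d) - 1) (m div d - 1)"
        using prime_power_dvd_gbinom[OF p md, of 0 "l div d"] by (intro mult_dvd_mono) auto
      then have "int p ^ (2 * a) dvd gbinom (int (m div d)) (l div d) * gbinom (int (m div d) * \<tau> + int (l div d) - 1) (m div d - 1)"
        by (simp add: mult_2 power_add)
      then show ?thesis
        unfolding signed_binoms_def by (simp only: mult.assoc dvd_mult)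
    qed simp
  qed
next
  case True
  show ?thesis
  proof (cases a)
    case (Suc b)
    let ?g = "\<lambda>d. moebius d * signed_binoms \<tau> (m div d) (l div d)"
    define D where "D = {d. 0 < d \<and> d dvd m \<and> d dvd l}"
    define A where "A = {d \<in> D. \<not> p dvd d}"
    have pos: "p > 0" using p prime_gt_0_nat by blast
    have finD: "finite D" using \<open>m > 0\<close> unfolding D_def by auto
    have sub: "A \<union> (\<lambda>d. p * d) ` A \<subseteq> D"
    proof -
      have "p * d \<in> D" if "d \<in> A" for d
      proof -
        have "coprime p d" using that p by (simp add: A_def prime_imp_coprime)
        then show ?thesis using that True pos by (simp add: A_def D_def divides_mult)
      qed
      then show ?thesis by (auto simp: A_def)
    qed
    \<comment> \<open>Such a \<open>d\<close> is \<open>p * c\<close> with \<open>c\<close> outside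
      \<open>A\<close>, hence divisible by \<open>p ^ 2\<close>.\<close>
    have rest: "?g d = 0" if "d \<in> D - (A \<union> (\<lambda>d. p * d) ` A)" for d
    proof -
      have "p dvd d" using that by (auto simp: A_def)
      then obtain c where c: "d = p * c" by (rule dvdE)
      then have "c \<in> D" using that by (auto simp: D_def intro: dvd_mult_right)
      then have "p dvd c" using that c by (auto simp: A_def)
      then have "p ^ 2 dvd d" using c by (simp add: power2_eq_square)
      then show ?thesis using moebius_square_dvd[OF p] by simp
    qed
    have "moebius_binom_sum \<tau> m l = sum ?g D" by (simp add: moebius_binom_sum_def D_def)
    also have "\<dots> = sum ?g (A \<union> (\<lambda>d. p * d) ` A)"
      using finD sub rest by (intro sum.mono_neutral_right) auto
    also have "\<dots> = sum ?g A + sum ?g ((\<lambda>d. p * d) ` A)"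
      using finD by (intro sum.union_disjoint) (auto simp: A_def)
    also have "sum ?g ((\<lambda>d. p * d) ` A) = (\<Sum>d\<in>A. ?g (p * d))"
      using pos by (subst sum.reindex) (auto simp: inj_on_def)
    finally have sum: "moebius_binom_sum \<tau> m l = (\<Sum>d\<in>A. ?g d + ?g (p * d))"
      by (simp add: sum.distrib)
    show ?thesis
      unfolding sum
    proof (rule dvd_sum)
      fix d assume d: "d \<in> A"
      then have "p * d \<in> D" using sub by auto
      then obtain m' l' where m': "m = p * d * m'" and l': "l = p * d * l'"
        by (auto simp: D_def elim!: dvdE)
      have dpos: "d > 0" using d by (auto simp: A_def D_def)
      have "m' > 0" using \<open>m > 0\<close> m' by (auto intro: Nat.gr0I)
      have quot: "m div d = p * m'" "l div d = p * l'" "m div (p * d) = m'" "l div (p * d) = l'"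
        using m' l' dpos pos by auto
      have "p ^ Suc b dvd p * m'"
        using prime_power_dvd_div[OF p m, of d] d unfolding quot Suc by (simp add: A_def D_def)
      then have "int p ^ (2 * a) dvd signed_binoms \<tau> (p * m') (p * l') - signed_binoms \<tau> m' l'"
        using signed_binoms_prime_cong[OF p _ \<open>m' > 0\<close>] Suc by blast
      \<comment> \<open>The opposite Moebius values turn the pair into a difference.\<close>
      moreover have "?g d + ?g (p * d) = moebius d * (signed_binoms \<tau> (p * m') (p * l') - signed_binoms \<tau> m' l')"
        using d unfolding quot by (simp add: moebius_prime_mult[OF p] A_def right_diff_distrib)
      ultimately show "int p ^ (2 * a) dvd ?g d + ?g (p * d)" by simp
    qed
  qed simp
qed

section \<open>Integrality from all primes together\<close>

lemma square_dvd_moebius_binom_sum: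
  assumes "m > 0"
  shows "int m ^ 2 dvd moebius_binom_sum \<tau> m l"
proof (cases "moebius_binom_sum \<tau> m l = 0")
  case False
  \<comment> \<open>Multiplicities are compared prime by prime, which requires the sum to be
    nonzero.\<close>
  define S where "S = nat \<bar>moebius_binom_sum \<tau> m l\<bar>"
  have "m ^ 2 dvd S"
  proof (rule multiplicity_le_imp_dvd)
    fix p :: nat assume p: "prime p"
    have "int p ^ (2 * multiplicity p m) dvd moebius_binom_sum \<tau> m l"
      using p assms by (intro prime_power_dvd_moebius_binom_sum) (auto simp: multiplicity_dvd)
    then have "p ^ (2 * multiplicity p m) dvd S"
      by (simp add: S_def nat_abs_dvd_iff flip: of_nat_power)
    then have "2 * multiplicity p m \<le> multiplicity p S"
      using False p by (intro multiplicity_geI) (auto simp: S_def)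
    then show "multiplicity p (m ^ 2) \<le> multiplicity p S"
      using p assms by (simp add: prime_elem_multiplicity_power_distrib)
  qed (use assms in simp)
  then show ?thesis by (simp add: S_def flip: of_nat_power)
qed simp

theorem theorem1p1:
  fixes \<tau> :: int and m l :: nat
  assumes "m \<ge> 1"
  shows "n_coef \<tau> m l \<in> \<int>"
proof -
  have "m > 0" using assms by simp
  then obtain q where "moebius_binom_sum \<tau> m l = int m ^ 2 * q"
    using square_dvd_moebius_binom_sum by (metis dvdE)
  then have "n_coef \<tau> m l = of_int (- q)"
    using \<open>m > 0\<close> by (simp add: n_coef_eq)
  then show ?thesis by (metis Ints_of_int)
qed

end
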